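(* $\mathrm{N}(3) = 4\cdot 3 - 5 = 7$. That is, every nonsingular unsatisfiable hitting clause-set $F$ with $\delta(F)=3$ satisfies $n(F)\le 7$, and $7$ is the supremum of $n(F)$ over all such $F$.
   Context: Variables are positive integers, literals are nonzero integers, and the complement of a literal $x$ is $\overline{x}=-x$; $\mathrm{var}(x)=|x|$. A clause is a finite set $C$ of literals containing no pair $x,\overline{x}$. A clause-set is a finite set of clauses. $\mathrm{var}(F)$ is the set of variables occurring in $F$, $n(F)=|\mathrm{var}(F)|$, $c(F)=|F|$, and the deficiency is $\delta(F)=c(F)-n(F)$. $F$ is satisfiable if there is a clause $C$ with $C\cap D\neq\emptyset$ for all $D\in F$, otherwise unsatisfiable. $F$ is a hitting clause-set if for all distinct $C,D\in F$ there is $x\in C$ with $\overline{x}\in D$. For a literal $x$, $\mathrm{ldeg}_F(x)$ is the number of clauses of $F$ containing $x$. A variable $v\in\mathrm{var}(F)$ is singular if $\min(\mathrm{ldeg}_F(v),\mathrm{ldeg}_F(\overline{v}))=1$; $F$ is nonsingular if it has no singular variable. For $k\in\mathbb{N}$, $\mathrm{N}(k)\in\mathbb{N}_0\cup\{+\infty\}$ denotes the supremum of $n(F)$ over all nonsingular unsatisfiable hitting clause-sets $F$ with $\delta(F)=k$. *)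

theory Defs
  imports Main "HOL-Library.Extended_Nat"
begin

(* Literals are nonzero integers, the complement of x is - x. *)

type_synonym literal = int
type_synonym clause = "literal set"
type_synonym clause_set = "clause set"

definition is_clause :: "clause \<Rightarrow> bool" where
  "is_clause C \<longleftrightarrow> finite C \<and> 0 \<notin> C \<and> \<not> (\<exists>x. x \<in> C \<and> - x \<in> C)"

definition is_clause_set :: "clause_set \<Rightarrow> bool" where
  "is_clause_set F \<longleftrightarrow> finite F \<and> (\<forall>C\<in>F. is_clause C)"

definition lit_var :: "literal \<Rightarrow> int" where
  "lit_var x = \<bar>x\<bar>"

definition vars :: "clause_set \<Rightarrow> int set" where
  "vars F = lit_var ` \<Union>F"

definition num_vars :: "clause_set \<Rightarrow> nat" where
  "num_vars F = card (vars F)"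

definition num_clauses :: "clause_set \<Rightarrow> nat" where
  "num_clauses F = card F"

definition deficiency :: "clause_set \<Rightarrow> int" where
  "deficiency F = int (num_clauses F) - int (num_vars F)"

definition satisfiable :: "clause_set \<Rightarrow> bool" where
  "satisfiable F \<longleftrightarrow> (\<exists>C. is_clause C \<and> (\<forall>D\<in>F. C \<inter> D \<noteq> {}))"

definition hitting :: "clause_set \<Rightarrow> bool" where
  "hitting F \<longleftrightarrow> (\<forall>C\<in>F. \<forall>D\<in>F. C \<noteq> D \<longrightarrow> (\<exists>x\<in>C. - x \<in> D))"

definition ldeg :: "clause_set \<Rightarrow> literal \<Rightarrow> nat" where
  "ldeg F x = card {C \<in> F. x \<in> C}"

definition singular_var :: "clause_set \<Rightarrow> int \<Rightarrow> bool" where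
  "singular_var F v \<longleftrightarrow> v \<in> vars F \<and> min (ldeg F v) (ldeg F (- v)) = 1"

definition nonsingular :: "clause_set \<Rightarrow> bool" where
  "nonsingular F \<longleftrightarrow> \<not> (\<exists>v. singular_var F v)"

definition nonsingular_uhit :: "nat \<Rightarrow> clause_set set" where
  "nonsingular_uhit k =
     {F. is_clause_set F \<and> nonsingular F \<and> \<not> satisfiable F \<and> hitting F \<and> deficiency F = int k}"

(* N(k); the supremum is taken in enat, with values in the natural numbers with 0
   extended by infinity. *)
definition sup_num_vars :: "nat \<Rightarrow> enat" where
  "sup_num_vars k = (SUP F\<in>nonsingular_uhit k. enat (num_vars F))"

end

theory Submission
  imports Defs
begin

text \<open>
  Read a clause as the subcube of all assignments that make every literal of it true; an
  unsatisfiable hitting clause-set \<open>F\<close> is then a partition of the Boolean cube into \<open>c\<close> subcubes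
  mentioning \<open>n\<close> coordinates. Let \<open>u\<close> be the number of literals of degree 1. For \<open>c - n \<le> 3\<close> the
  inequality \<open>n \<le> 4 (c - n) - 5 + u\<close> is proved by induction on \<open>n\<close>, where \<open>F = {{}}\<close> counts as
  having \<open>u = 1\<close>; the upper bound 7 is the case \<open>u = 0\<close>, \<open>c - n = 3\<close>.

  If the literal \<open>w\<close> occurs in only one clause \<open>C\<close>, then all clauses with \<open>- w\<close> contain \<open>C - {w}\<close>,
  so \<open>F\<close> arises by substituting a partition \<open>E\<close> into one subcube of a partition \<open>G\<close>. The
  inequalities for \<open>E\<close> and \<open>G\<close> add up to the one for \<open>F\<close>, since a clause contains at most one
  literal of degree 1.

  If there is no such literal, split on a variable of minimal degree. No other variable disappears
  in the two halves, so the bound \<open>n < c\<close> for the halves limits both literal degrees to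
  \<open>c - n \<le> 3\<close>. A literal of degree 1 in one half must occur in a clause belonging only to the other
  half. In the cases (2,2) and (2,3) the same region is partitioned into two subcubes on one side
  and into two or three on the other, which leaves room for at most 3 resp. 6 such literals; in the
  case (3,3) a half has \<open>c - n = 1\<close> and hence a variable with both degrees 1, which contradicts
  minimality.
\<close>

section \<open>Assignments, partitions into subcubes, restriction\<close>

text \<open>A total assignment, given as the set of its true literals. The integer 0 is no literal
  and is left free.\<close>

definition assignment :: "literal set \<Rightarrow> bool" where
  "assignment S \<longleftrightarrow> (\<forall>x. x \<noteq> 0 \<longrightarrow> (x \<in> S \<longleftrightarrow> - x \<notin> S))"

text \<open>With \<open>S\<close> read as the set of falsified literals, existence of
  \<open>C\<close> is unsatisfiability and uniqueness is the hitting condition.\<close>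

definition uhit :: "clause_set \<Rightarrow> bool" where
  "uhit F \<longleftrightarrow> is_clause_set F \<and> (\<forall>S. assignment S \<longrightarrow> (\<exists>!C. C \<in> F \<and> C \<subseteq> S))"

text \<open>For clauses this says that the two subcubes intersect.\<close>

definition compatible :: "clause \<Rightarrow> clause \<Rightarrow> bool" where
  "compatible A C \<longleftrightarrow> (\<forall>x\<in>A. - x \<notin> C)"

text \<open>The partition that \<open>F\<close> induces on the subcube of \<open>A\<close>, written
  in the coordinates that \<open>A\<close> leaves free.\<close>

definition restr :: "clause \<Rightarrow> clause_set \<Rightarrow> clause_set" where
  "restr A F = (\<lambda>C. C - A) ` {C \<in> F. compatible A C}"

definition unit_lits :: "clause_set \<Rightarrow> literal set" where
  "unit_lits F = {y. ldeg F y = 1}"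

text \<open>The extra summand turns \<open>5 * n + 5 \<le> 4 * c + u\<close> into an equality for
  \<open>{{}}\<close>, where \<open>n = 0\<close>, \<open>c = 1\<close> and no literal
  occurs.\<close>

definition unit_count :: "clause_set \<Rightarrow> nat" where
  "unit_count F = card (unit_lits F) + (if F = {{}} then 1 else 0)"

lemma assignment_extending:
  assumes "0 \<notin> C" "\<And>x. x \<in> C \<Longrightarrow> - x \<notin> C"
  obtains S where "assignment S" "C \<subseteq> S"
proof
  \<comment> \<open>Variables that \<open>C\<close> leaves open are set to true.\<close>
  show "assignment (C \<union> {x. x > 0 \<and> - x \<notin> C})"
    unfolding assignment_def
  proof (intro allI impI)
    fix x :: int assume "x \<noteq> 0"
    then consider "x > 0" | "x < 0" by linarith
    then show "x \<in> C \<union> {x. x > 0 \<and> - x \<notin> C} \<longleftrightarrow> - x \<notin> C \<union> {x. x > 0 \<and> - x \<notin> C}"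
      using assms(2)[of x] assms(2)[of "- x"] by cases auto
  qed
qed auto

lemma assignment_override:
  assumes "assignment S" "is_clause A"
  shows "assignment ((S - uminus ` A) \<union> A)"
proof -
  have 1: "x \<in> uminus ` A \<longleftrightarrow> - x \<in> A" for x :: int
    by (force simp: image_iff)
  show ?thesis
    unfolding assignment_def
  proof (intro allI impI)
    fix x :: int assume "x \<noteq> 0"
    then have "x \<in> S \<longleftrightarrow> - x \<notin> S" using assms(1) unfolding assignment_def by blast
    moreover have "\<not> (x \<in> A \<and> - x \<in> A)" using assms(2) unfolding is_clause_def by blast
    ultimately show "x \<in> S - uminus ` A \<union> A \<longleftrightarrow> - x \<notin> S - uminus ` A \<union> A"
      using 1[of x] 1[of "- x"] by auto
  qed
qed

lemma is_clause_subset: "is_clause C \<Longrightarrow> D \<subseteq> C \<Longrightarrow> is_clause D"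
  unfolding is_clause_def by (meson finite_subset subsetD)

lemma is_clause_singleton: "x \<noteq> 0 \<Longrightarrow> is_clause {x}"
  unfolding is_clause_def by auto

lemma clause_extending:
  assumes "is_clause C" obtains S where "assignment S" "C \<subseteq> S"
  using assms assignment_extending[of C] unfolding is_clause_def by metis

section \<open>Basic properties of partitions into subcubes\<close>

context
  fixes F assumes F: "uhit F"
begin

lemma uhit_finite: "finite F"
  using F unfolding uhit_def is_clause_set_def by blast

lemma uhit_clause: "C \<in> F \<Longrightarrow> is_clause C"
  using F unfolding uhit_def is_clause_set_def by blast

lemma uhit_ex: assumes "assignment S" obtains C where "C \<in> F" "C \<subseteq> S"
  using F assms unfolding uhit_def by blast

lemma uhit_unique:
  "assignment S \<Longrightarrow> C \<in> F \<Longrightarrow> D \<in> F \<Longrightarrow> C \<subseteq> S \<Longrightarrow> D \<subseteq> S \<Longrightarrow> C = D"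
  using F unfolding uhit_def by blast

lemma uhit_lits_finite: "finite (\<Union>F)"
  using uhit_finite uhit_clause unfolding is_clause_def by blast

lemma uhit_lits_nonzero: "x \<in> \<Union>F \<Longrightarrow> x \<noteq> 0"
  using uhit_clause unfolding is_clause_def by blast

lemma uhit_nonempty: "F \<noteq> {}"
  using uhit_ex[of "{x. x > 0}"] unfolding assignment_def by force

lemma uhit_clash:
  assumes "C \<in> F" "D \<in> F" "C \<noteq> D"
  obtains x where "x \<in> C" "- x \<in> D"
proof (rule ccontr)
  assume "\<not> thesis"
  with that have n: "\<And>x. x \<in> C \<Longrightarrow> - x \<notin> D" by blast
  obtain S where "assignment S" "C \<union> D \<subseteq> S"
  proof (rule assignment_extending[of "C \<union> D"])
    show "0 \<notin> C \<union> D" using assms uhit_clause unfolding is_clause_def by blast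
    show "- x \<notin> C \<union> D" if "x \<in> C \<union> D" for x
      using that n[of x] n[of "- x"] uhit_clause[OF assms(1)] uhit_clause[OF assms(2)]
      unfolding is_clause_def by auto
  qed
  then show False using uhit_unique assms by blast
qed

text \<open>Flipping \<open>x\<close> leaves the subcube of \<open>C\<close>. The clause
  \<open>D\<close> of the new assignment must contain \<open>- x\<close>, since otherwise it would
  already lie in \<open>S\<close> and equal \<open>C\<close>.\<close>

lemma uhit_flip:
  assumes "assignment S" "C \<in> F" "x \<in> C" "C \<subseteq> S"
  obtains D where "D \<in> F" "- x \<in> D" "D \<subseteq> insert (- x) (S - {x})"
proof -
  have x: "x \<noteq> 0" using assms uhit_lits_nonzero by blast
  then have "assignment ((S - uminus ` {- x}) \<union> {- x})"
    using assignment_override[OF assms(1) is_clause_singleton[of "- x"]] by simp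
  then obtain D where D: "D \<in> F" "D \<subseteq> insert (- x) (S - {x})"
    using uhit_ex by (metis Un_insert_right image_insert image_empty minus_minus sup_bot_right)
  have "- x \<in> D"
  proof (rule ccontr)
    assume "- x \<notin> D"
    then have "D = C" using D assms uhit_unique by blast
    with D assms(3) x show False by auto
  qed
  with D that show thesis by blast
qed

lemma uhit_lits_uminus: "x \<in> \<Union>F \<Longrightarrow> - x \<in> \<Union>F"
  using uhit_flip clause_extending uhit_clause by (metis UnionE UnionI)

lemma uhit_lits_uminus_iff: "- x \<in> \<Union>F \<longleftrightarrow> x \<in> \<Union>F"
  using uhit_lits_uminus[of x] uhit_lits_uminus[of "- x"] by auto

lemma uhit_ldeg_pos_iff: "ldeg F x > 0 \<longleftrightarrow> x \<in> \<Union>F"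
  using uhit_finite unfolding ldeg_def by (auto simp: card_gt_0_iff)

lemma unit_lits_subset: "unit_lits F \<subseteq> \<Union>F"
proof
  show "y \<in> \<Union>F" if "y \<in> unit_lits F" for y
    using that uhit_ldeg_pos_iff[of y] unfolding unit_lits_def by simp
qed

text \<open>Overriding \<open>S\<close> by \<open>A\<close> gives an assignment in the subcube of
  \<open>A\<close>; by \<open>sub\<close>, the clauses of \<open>F\<close> inside it are the
  compatible ones whose remainder lies in \<open>S\<close>. Both claims thus reduce to existence and
  uniqueness for \<open>F\<close>.\<close>

lemma uhit_restr:
  assumes A: "is_clause A"
  shows "uhit (restr A F)" "inj_on (\<lambda>C. C - A) {C \<in> F. compatible A C}"
proof -
  have sub: "C \<subseteq> (S - uminus ` A) \<union> A \<longleftrightarrow> compatible A C \<and> C - A \<subseteq> S" for C S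
  proof -
    have "x \<notin> uminus ` A" if "x \<in> A" for x
      using that A unfolding is_clause_def by force
    then show ?thesis
      unfolding compatible_def by (force simp: image_iff)
  qed
  show inj: "inj_on (\<lambda>C. C - A) {C \<in> F. compatible A C}"
  proof (rule inj_onI)
    fix C D assume C: "C \<in> {C \<in> F. compatible A C}" and D: "D \<in> {C \<in> F. compatible A C}"
      and eq: "C - A = D - A"
    have "is_clause (C - A)" using C uhit_clause is_clause_subset by blast
    then obtain S where S: "assignment S" "C - A \<subseteq> S" using clause_extending by blast
    show "C = D"
      using uhit_unique[OF assignment_override[OF S(1) A], of C D] sub[of C S] sub[of D S] C D S eq by simp
  qed
  have "is_clause_set (restr A F)"
    using uhit_finite uhit_clause is_clause_subset unfolding is_clause_set_def restr_def by force
  moreover have "\<exists>!C. C \<in> restr A F \<and> C \<subseteq> S" if S: "assignment S" for S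
  proof -
    have S': "assignment ((S - uminus ` A) \<union> A)" using assignment_override S A by blast
    obtain C where C: "C \<in> F" "C \<subseteq> (S - uminus ` A) \<union> A" using uhit_ex S' by blast
    show ?thesis
    proof (rule ex1I[of _ "C - A"])
      show "C - A \<in> restr A F \<and> C - A \<subseteq> S" using C sub unfolding restr_def by blast
      show "D = C - A" if D: "D \<in> restr A F \<and> D \<subseteq> S" for D
      proof -
        obtain B where B: "B \<in> F" "compatible A B" "D = B - A"
          using D unfolding restr_def by blast
        then have "B \<subseteq> (S - uminus ` A) \<union> A" using D sub by blast
        then show ?thesis using uhit_unique[OF S'] B C by blast
      qed
    qed
  qed
  ultimately show "uhit (restr A F)" unfolding uhit_def by blast
qed

lemma card_restr: "is_clause A \<Longrightarrow> card (restr A F) = card {C \<in> F. compatible A C}"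
  unfolding restr_def using uhit_restr(2) card_image by blast

lemma ldeg_restr:
  assumes "is_clause A" "y \<notin> A"
  shows "ldeg (restr A F) y = card {C \<in> F. compatible A C \<and> y \<in> C}"
proof -
  have "{C \<in> restr A F. y \<in> C} = (\<lambda>C. C - A) ` {C \<in> F. compatible A C \<and> y \<in> C}"
    using assms unfolding restr_def by auto
  moreover have "inj_on (\<lambda>C. C - A) {C \<in> F. compatible A C \<and> y \<in> C}"
    by (rule inj_on_subset[OF uhit_restr(2)[OF assms(1)]]) auto
  ultimately show ?thesis unfolding ldeg_def by (simp add: card_image)
qed

text \<open>Every variable occurs with both signs. This allows counting literals instead of
  variables throughout.\<close>

lemma card_lits: "card (\<Union>F) = 2 * num_vars F"
proof -
  have v: "vars F = {x \<in> \<Union>F. x > 0}"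
  proof
    show "vars F \<subseteq> {x \<in> \<Union>F. x > 0}"
    proof
      fix y assume "y \<in> vars F"
      then obtain x where x: "x \<in> \<Union>F" "y = \<bar>x\<bar>" unfolding vars_def lit_var_def by blast
      then have "y > 0" using uhit_lits_nonzero by simp
      moreover have "y = x \<or> y = - x" using x by linarith
      ultimately show "y \<in> {x \<in> \<Union>F. x > 0}" using x uhit_lits_uminus by blast
    qed
    show "{x \<in> \<Union>F. x > 0} \<subseteq> vars F"
      unfolding vars_def lit_var_def by (force simp: image_iff)
  qed
  have "\<Union>F = vars F \<union> uminus ` vars F"
  proof
    show "\<Union>F \<subseteq> vars F \<union> uminus ` vars F"
    proof
      fix x assume x: "x \<in> \<Union>F"
      show "x \<in> vars F \<union> uminus ` vars F"
      proof (cases "x > 0")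
        case False
        then have "- x \<in> vars F" using x uhit_lits_uminus uhit_lits_nonzero[of x] v by force
        then show ?thesis by (metis UnI2 imageI minus_minus)
      qed (use x v in auto)
    qed
    show "vars F \<union> uminus ` vars F \<subseteq> \<Union>F"
      using v uhit_lits_uminus by blast
  qed
  moreover have "vars F \<inter> uminus ` vars F = {}" using v by auto
  moreover have "finite (vars F)" unfolding vars_def using uhit_lits_finite by simp
  ultimately have "card (\<Union>F) = card (vars F) + card (uminus ` vars F)"
    by (metis card_Un_disjoint finite_imageI)
  then show ?thesis unfolding num_vars_def by (simp add: card_image)
qed

end

lemma restr_lits:
  "\<Union>(restr A F) \<subseteq> \<Union>F - A - uminus ` A"
  unfolding restr_def compatible_def by (auto simp: image_iff)

lemma compatible_singleton: "compatible {x} C \<longleftrightarrow> - x \<notin> C"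
  unfolding compatible_def by simp

lemma card_restr_singleton:
  assumes "uhit F" "x \<in> \<Union>F"
  shows "card (restr {x} F) + ldeg F (- x) = card F"
proof -
  have "card F = card {C \<in> F. - x \<notin> C} + card {C \<in> F. - x \<in> C}"
    using uhit_finite[OF assms(1)] by (subst card_Un_disjoint[symmetric]) (auto intro: arg_cong[where f=card])
  then show ?thesis
    using card_restr[OF assms(1) is_clause_singleton[of x]] uhit_lits_nonzero[OF assms]
    unfolding compatible_singleton ldeg_def by simp
qed

section \<open>Splitting on a variable of minimal degree\<close>

lemma min_degree_literal:
  assumes "uhit F" "\<Union>F \<noteq> {}"
  obtains x where "x \<in> \<Union>F"
    "\<And>y. y \<in> \<Union>F \<Longrightarrow> ldeg F x + ldeg F (- x) \<le> ldeg F y + ldeg F (- y)"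
proof -
  let ?f = "\<lambda>y. ldeg F y + ldeg F (- y)"
  have "\<exists>x. is_arg_min ?f (\<lambda>y. y \<in> \<Union>F) x"
    using ex_is_arg_min_if_finite[OF uhit_lits_finite[OF assms(1)] assms(2)] .
  then show thesis using that unfolding is_arg_min_def by (meson not_le)
qed

text \<open>If another variable \<open>y\<close> disappeared, every clause with \<open>y\<close> or
  \<open>- y\<close> would contain \<open>- x\<close>. Its degree would be at most
  \<open>ldeg F (- x)\<close>, which is below the minimum because
  \<open>ldeg F x > 0\<close>.\<close>

lemma lits_restr_min_degree:
  assumes F: "uhit F" and x: "x \<in> \<Union>F"
    and min: "\<And>y. y \<in> \<Union>F \<Longrightarrow> ldeg F x + ldeg F (- x) \<le> ldeg F y + ldeg F (- y)"
  shows "\<Union>(restr {x} F) = \<Union>F - {x, - x}"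
proof
  show "\<Union>(restr {x} F) \<subseteq> \<Union>F - {x, - x}" using restr_lits[of "{x}" F] by auto
  have R: "uhit (restr {x} F)"
    using uhit_restr(1)[OF F is_clause_singleton] uhit_lits_nonzero[OF F x] by blast
  show "\<Union>F - {x, - x} \<subseteq> \<Union>(restr {x} F)"
  proof
    fix y assume y: "y \<in> \<Union>F - {x, - x}"
    show "y \<in> \<Union>(restr {x} F)"
    proof (rule ccontr)
      assume n: "y \<notin> \<Union>(restr {x} F)"
      then have n': "- y \<notin> \<Union>(restr {x} F)" using uhit_lits_uminus_iff[OF R] by blast
      have sub: "- x \<in> C" if "C \<in> F" "z \<in> C" "z \<noteq> x" "z \<notin> \<Union>(restr {x} F)" for C z
        using that unfolding restr_def compatible_singleton by blast
      have "ldeg F y + ldeg F (- y) = card ({C \<in> F. y \<in> C} \<union> {C \<in> F. - y \<in> C})"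
        unfolding ldeg_def using uhit_finite[OF F] uhit_clause[OF F]
        by (subst card_Un_disjoint) (auto simp: is_clause_def)
      also have "\<dots> \<le> ldeg F (- x)"
        unfolding ldeg_def using n n' sub[of _ y] sub[of _ "- y"] y uhit_finite[OF F]
        by (intro card_mono) (auto simp del: Union_iff)
      finally show False
        using min[of y] y uhit_ldeg_pos_iff[OF F, of x] x by (auto simp del: Union_iff)
    qed
  qed
qed

lemma num_vars_restr_min_degree:
  assumes F: "uhit F" and x: "x \<in> \<Union>F"
    and min: "\<And>y. y \<in> \<Union>F \<Longrightarrow> ldeg F x + ldeg F (- x) \<le> ldeg F y + ldeg F (- y)"
  shows "num_vars (restr {x} F) + 1 = num_vars F"
proof -
  have x0: "x \<noteq> 0" using uhit_lits_nonzero[OF F x] .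
  have "card (\<Union>F) = card (\<Union>F - {x, - x}) + card {x, - x}"
    using x uhit_lits_uminus[OF F x] uhit_lits_finite[OF F]
    by (subst card_Un_disjoint[symmetric]) (auto intro: arg_cong[where f=card])
  then show ?thesis
    using lits_restr_min_degree[OF assms] card_lits[OF F]
      card_lits[OF uhit_restr(1)[OF F is_clause_singleton[OF x0]]] x0 by auto
qed

lemma no_lits_uhit:
  assumes "uhit F" "\<Union>F = {}"
  shows "F = {{}}"
proof -
  have "F \<subseteq> {{}}" using assms(2) by auto
  then show ?thesis using uhit_nonempty[OF assms(1)] subset_singletonD by blast
qed

text \<open>Tarsi's lemma for partitions. A split on a variable of minimal degree loses exactly one
  variable and at least one clause.\<close>

lemma num_vars_less_card:
  "uhit F \<Longrightarrow> num_vars F < card F"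
proof (induction "num_vars F" arbitrary: F rule: less_induct)
  case less
  show ?case
  proof (cases "\<Union>F = {}")
    case True
    then have "F = {{}}" using no_lits_uhit less.prems by blast
    then show ?thesis by (simp add: num_vars_def vars_def)
  next
    case False
    obtain x where x: "x \<in> \<Union>F"
      "\<And>y. y \<in> \<Union>F \<Longrightarrow> ldeg F x + ldeg F (- x) \<le> ldeg F y + ldeg F (- y)"
      using min_degree_literal[OF less.prems False] by blast
    have R: "uhit (restr {x} F)"
      using uhit_restr(1)[OF less.prems is_clause_singleton] uhit_lits_nonzero[OF less.prems x(1)] by blast
    have n: "num_vars (restr {x} F) + 1 = num_vars F"
      using num_vars_restr_min_degree[OF less.prems x] .
    have "num_vars (restr {x} F) < card (restr {x} F)" using less.hyps[OF _ R] n by simp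
    moreover have "ldeg F (- x) > 0"
      using uhit_ldeg_pos_iff[OF less.prems] uhit_lits_uminus[OF less.prems x(1)] by blast
    ultimately show ?thesis using card_restr_singleton[OF less.prems x(1)] n by simp
  qed
qed

section \<open>Literals of degree 1 and decomposition\<close>

lemma unit_clause_unique:
  assumes "ldeg F w = 1" "C \<in> F" "w \<in> C" "D \<in> F" "w \<in> D"
  shows "D = C"
  using assms unfolding ldeg_def by (metis (mono_tags, lifting) card_1_singletonE mem_Collect_eq singletonD)

text \<open>If some \<open>c\<close> of \<open>C\<close> were missing in \<open>D\<close>, an
  assignment inside \<open>D\<close> could make \<open>c\<close> false. Flipping \<open>- w\<close>
  there leads to a clause with \<open>w\<close>, hence to \<open>C\<close>, which needs
  \<open>c\<close> true.\<close>

lemma unit_clause_subset: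
  assumes F: "uhit F" and w: "ldeg F w = 1" and C: "C \<in> F" "w \<in> C" and D: "D \<in> F" "- w \<in> D"
  shows "C - {w} \<subseteq> D"
proof
  fix c assume c: "c \<in> C - {w}"
  have clC: "is_clause C" and clD: "is_clause D" using uhit_clause[OF F] C D by auto
  show "c \<in> D"
  proof (rule ccontr)
    assume nc: "c \<notin> D"
    have "0 \<notin> insert (- c) D" using clC clD c unfolding is_clause_def by auto
    moreover have "- x \<notin> insert (- c) D" if "x \<in> insert (- c) D" for x
      using that clC clD c nc unfolding is_clause_def by (cases "x = - c") (auto simp: minus_equation_iff)
    ultimately obtain S where S: "assignment S" "insert (- c) D \<subseteq> S"
      using assignment_extending[of "insert (- c) D"] by blast
    obtain B where B: "B \<in> F" "w \<in> B" "B \<subseteq> insert w (S - {- w})"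
      using uhit_flip[OF F S(1) D] S(2) by auto
    have "B = C" using unit_clause_unique[OF w C B(1,2)] .
    then have "c \<in> S" using B c by auto
    moreover have "- c \<in> S" using S by auto
    moreover have "c \<noteq> 0" using clC c unfolding is_clause_def by auto
    ultimately show False using S(1) unfolding assignment_def by blast
  qed
qed

text \<open>For two such literals \<open>y\<close>, \<open>z\<close> in \<open>C\<close>, a clause
  with \<open>- y\<close> would contain \<open>z\<close> by \<open>unit_clause_subset\<close>, hence
  be \<open>C\<close> itself, which contains \<open>y\<close>.\<close>

lemma card_unit_lits_clause:
  assumes F: "uhit F" and C: "C \<in> F"
  shows "card (unit_lits F \<inter> C) \<le> 1"
proof -
  have fin: "finite (unit_lits F \<inter> C)"
    using uhit_clause[OF F C] unfolding is_clause_def by auto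
  have "y = z" if y: "y \<in> unit_lits F \<inter> C" and z: "z \<in> unit_lits F \<inter> C" for y z
  proof (rule ccontr)
    assume ne: "y \<noteq> z"
    have "- y \<in> \<Union>F" using uhit_lits_uminus[OF F] y C by blast
    then obtain D where D: "D \<in> F" "- y \<in> D" by blast
    have "z \<in> D" using unit_clause_subset[OF F _ C _ D] y z ne unfolding unit_lits_def by auto
    then have "D = C" using unit_clause_unique[OF _ C _ D(1)] z unfolding unit_lits_def by auto
    then show False using D y uhit_clause[OF F C] unfolding is_clause_def by auto
  qed
  then show ?thesis using card_le_Suc0_iff_eq[OF fin] by simp
qed

lemma finite_unit_lits: "uhit F \<Longrightarrow> finite (unit_lits F)"
  using finite_subset[OF unit_lits_subset uhit_lits_finite] .

lemma unit_lits_empty_clause: "unit_lits {{}} = {}"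
proof -
  have "{C \<in> {{}}. y \<in> C} = {}" for y :: literal by blast
  then show ?thesis unfolding unit_lits_def ldeg_def by (simp del: Collect_empty_eq)
qed

lemma ldeg_split:
  assumes "finite F"
  shows "ldeg F y = card {C \<in> F. - x \<notin> C \<and> y \<in> C} + card {C \<in> F. - x \<in> C \<and> y \<in> C}"
  unfolding ldeg_def using assms
  by (subst card_Un_disjoint[symmetric]) (auto intro: arg_cong[where f=card])

text \<open>\<open>G\<close> is the half \<open>w\<close>, in which \<open>C - {w}\<close> is one
  subcube; \<open>E\<close> is the partition of the opposite copy of that subcube by the clauses
  with \<open>- w\<close>. Shared variables are counted through the common literals, two per
  variable, so the variable count is doubled.\<close>

lemma singular_decomposition:
  assumes F: "uhit F" and w: "ldeg F w = 1"
  obtains G E where "uhit G" "uhit E" "card F = card G + card E"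
    "2 * num_vars F + card (\<Union>G \<inter> \<Union>E) = 2 * num_vars G + 2 * num_vars E + 2"
    "unit_count G + unit_count E \<le> unit_count F + 2 * card (\<Union>G \<inter> \<Union>E)"
proof -
  have wF: "w \<in> \<Union>F" using uhit_ldeg_pos_iff[OF F, of w] w by simp
  then obtain C where C: "C \<in> F" "w \<in> C" by blast
  have w0: "w \<noteq> 0" and mw: "- w \<in> \<Union>F"
    using uhit_lits_nonzero[OF F wF] uhit_lits_uminus[OF F wF] by auto
  have clC: "is_clause C" using uhit_clause[OF F C(1)] .
  define A where "A = insert (- w) (C - {w})"
  define G where "G = restr {w} F"
  define E where "E = restr A F"
  have clA: "is_clause A"
    using clC w0 C(2) unfolding is_clause_def A_def by (auto simp: minus_equation_iff)
  have clw: "is_clause {w}" using is_clause_singleton[OF w0] .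
  have G: "uhit G" and E: "uhit E"
    unfolding G_def E_def using uhit_restr(1)[OF F] clA clw by auto
  \<comment> \<open>A clause meeting the subcube of \<open>A\<close> can clash with \<open>C\<close>
    only in \<open>w\<close>; conversely, a clause with \<open>- w\<close> contains all of
    \<open>A\<close>. So \<open>E\<close> consists of exactly the clauses with
    \<open>- w\<close>.\<close>
  have comp: "compatible A D \<longleftrightarrow> - w \<in> D" if D: "D \<in> F" for D
  proof
    assume "compatible A D"
    then have c: "- x \<notin> D" if "x \<in> A" for x using that unfolding compatible_def by blast
    have "w \<notin> D" using c[of "- w"] unfolding A_def by simp
    then obtain x where x: "x \<in> C" "- x \<in> D" using uhit_clash[OF F C(1) D] C by blast
    then show "- w \<in> D" using c[of x] unfolding A_def by auto
  next
    assume m: "- w \<in> D"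
    have "A \<subseteq> D" using unit_clause_subset[OF F w C D m] m unfolding A_def by auto
    then show "compatible A D"
      using uhit_clause[OF F D] unfolding compatible_def is_clause_def by auto
  qed
  have cE: "card E = ldeg F (- w)"
    unfolding E_def card_restr[OF F clA] ldeg_def by (rule arg_cong[where f=card]) (use comp in auto)
  have cF: "card F = card G + card E"
    using card_restr_singleton[OF F wF] cE unfolding G_def by simp
  have CG: "C - {w} \<in> G"
    using C clC unfolding G_def restr_def compatible_singleton is_clause_def by blast
  have wG: "w \<notin> \<Union>G" "- w \<notin> \<Union>G" using restr_lits[of "{w}" F] unfolding G_def by auto
  have wE: "w \<notin> \<Union>E" "- w \<notin> \<Union>E"
    using restr_lits[of A F] unfolding E_def A_def by (auto simp: image_iff simp del: Union_iff)
  have GF: "\<Union>G \<subseteq> \<Union>F" and EF: "\<Union>E \<subseteq> \<Union>F"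
    using restr_lits unfolding G_def E_def by blast+
  have inG: "y \<in> \<Union>G" if "D \<in> F" "- w \<notin> D" "y \<in> D" "y \<noteq> w" for y D
    using that unfolding G_def restr_def compatible_singleton by blast
  have inE: "y \<in> \<Union>E" if "D \<in> F" "- w \<in> D" "y \<in> D" "y \<notin> A" for y D
    using that comp unfolding E_def restr_def by blast
  have lits: "\<Union>F = (\<Union>G \<union> \<Union>E) \<union> {w, - w}"
  proof
    show "\<Union>F \<subseteq> (\<Union>G \<union> \<Union>E) \<union> {w, - w}"
    proof
      fix y assume "y \<in> \<Union>F"
      then obtain D where D: "D \<in> F" "y \<in> D" by blast
      show "y \<in> (\<Union>G \<union> \<Union>E) \<union> {w, - w}"
        using inG[OF D(1) _ D(2)] inE[OF D(1) _ D(2)] CG unfolding A_def by blast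
    qed
  qed (use GF EF wF mw in blast)
  have fG: "finite (\<Union>G)" and fE: "finite (\<Union>E)" using uhit_lits_finite G E by auto
  have "card (\<Union>F) = card (\<Union>G \<union> \<Union>E) + card {w, - w}"
    unfolding lits using wG wE fG fE by (subst card_Un_disjoint) auto
  moreover have "card (\<Union>G) + card (\<Union>E) = card (\<Union>G \<union> \<Union>E) + card (\<Union>G \<inter> \<Union>E)"
    using card_Un_Int[OF fG fE] .
  ultimately have n: "2 * num_vars F + card (\<Union>G \<inter> \<Union>E) = 2 * num_vars G + 2 * num_vars E + 2"
    using card_lits F G E w0 by simp
  \<comment> \<open>\<open>UG\<close> and \<open>UE\<close> collect literals that keep degree 1 in
    \<open>F\<close>. Those of \<open>C - {w}\<close> are excluded, as they reappear in every clause
    with \<open>- w\<close>. If \<open>E = {{}}\<close>, only one clause contains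
    \<open>- w\<close>, so \<open>- w\<close> counts as well.\<close>
  define UG where "UG = unit_lits G - (C - {w}) - \<Union>E"
  define UE where "UE = unit_lits E - \<Union>G"
  define W where "W = (if E = {{}} then {w, - w} else {w})"
  have finF: "finite F" using uhit_finite[OF F] .
  have UG: "UG \<subseteq> unit_lits F"
  proof
    fix y assume y: "y \<in> UG"
    then have yG: "y \<in> \<Union>G" using unit_lits_subset[OF G] unfolding UG_def by blast
    then have yw: "y \<noteq> w" "y \<noteq> - w" using wG by auto
    then have "{D \<in> F. - w \<in> D \<and> y \<in> D} = {}"
      using y inE[of _ y] unfolding UG_def A_def by blast
    moreover have "card {D \<in> F. - w \<notin> D \<and> y \<in> D} = 1"
      using y ldeg_restr[OF F clw, of y] yw
      unfolding UG_def G_def unit_lits_def compatible_singleton by simp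
    ultimately show "y \<in> unit_lits F"
      using ldeg_split[OF finF, of y w] unfolding unit_lits_def by (simp only: card.empty) simp
  qed
  have UE: "UE \<subseteq> unit_lits F"
  proof
    fix y assume y: "y \<in> UE"
    then have yE: "y \<in> \<Union>E" using unit_lits_subset[OF E] unfolding UE_def by blast
    then have yw: "y \<noteq> w" "y \<notin> A" using wE restr_lits[of A F] unfolding E_def by blast+
    then have "{D \<in> F. - w \<notin> D \<and> y \<in> D} = {}"
      using y inG[of _ y] unfolding UE_def by blast
    moreover have "{D \<in> F. - w \<in> D \<and> y \<in> D} = {D \<in> F. compatible A D \<and> y \<in> D}"
      using comp by blast
    moreover have "card {D \<in> F. compatible A D \<and> y \<in> D} = 1"
      using y ldeg_restr[OF F clA, of y] yw unfolding UE_def E_def unit_lits_def by simp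
    ultimately show "y \<in> unit_lits F"
      using ldeg_split[OF finF, of y w] unfolding unit_lits_def by (simp only: card.empty) simp
  qed
  have W: "W \<subseteq> unit_lits F"
    using w cE unfolding W_def unit_lits_def by auto
  have sG: "UG \<subseteq> \<Union>G" and sE: "UE \<subseteq> \<Union>E - \<Union>G"
    using unit_lits_subset[OF G] unit_lits_subset[OF E] unfolding UG_def UE_def by auto
  have "card W + card UG + card UE = card (W \<union> UG \<union> UE)"
  proof -
    have "finite W" "finite UG" "finite UE"
      using finite_unit_lits[OF F] UG UE W by (auto intro: finite_subset)
    moreover have "W \<inter> UG = {}" "(W \<union> UG) \<inter> UE = {}"
      using sG sE wG wE unfolding W_def by (auto split: if_splits)
    ultimately show ?thesis by (simp add: card_Un_disjoint)
  qed
  also have "\<dots> \<le> card (unit_lits F)"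
    using UG UE W by (intro card_mono finite_unit_lits[OF F]) auto
  finally have le: "card W + card UG + card UE \<le> card (unit_lits F)" .
  \<comment> \<open>The literal \<open>w\<close> compensates for this loss of at most 1: a degree-1
    literal of \<open>G\<close> in \<open>C - {w}\<close>, or the extra summand for
    \<open>G = {{}}\<close>, but never both.\<close>
  have "card (unit_lits G \<inter> (C - {w})) + (if G = {{}} then 1 else 0) \<le> 1"
    using card_unit_lits_clause[OF G CG] unit_lits_empty_clause by auto
  moreover have "card (unit_lits G) \<le> card UG + card (unit_lits G \<inter> (C - {w})) + card (\<Union>G \<inter> \<Union>E)"
  proof -
    have "unit_lits G \<subseteq> UG \<union> (unit_lits G \<inter> (C - {w})) \<union> (\<Union>G \<inter> \<Union>E)"
      using unit_lits_subset[OF G] unfolding UG_def by blast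
    then have "card (unit_lits G) \<le> card (UG \<union> (unit_lits G \<inter> (C - {w})) \<union> (\<Union>G \<inter> \<Union>E))"
      using fG finite_unit_lits[OF G] unfolding UG_def by (intro card_mono) auto
    then show ?thesis
      using card_Un_le[of "UG \<union> (unit_lits G \<inter> (C - {w}))" "\<Union>G \<inter> \<Union>E"]
        card_Un_le[of UG "unit_lits G \<inter> (C - {w})"] by linarith
  qed
  moreover have "card (unit_lits E) \<le> card UE + card (\<Union>G \<inter> \<Union>E)"
  proof -
    have "unit_lits E \<subseteq> UE \<union> (\<Union>G \<inter> \<Union>E)"
      using unit_lits_subset[OF E] unfolding UE_def by blast
    then have "card (unit_lits E) \<le> card (UE \<union> (\<Union>G \<inter> \<Union>E))"
      using fG finite_unit_lits[OF E] unfolding UE_def by (intro card_mono) auto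
    then show ?thesis using card_Un_le[of UE "\<Union>G \<inter> \<Union>E"] by linarith
  qed
  moreover have "card W = 1 + (if E = {{}} then 1 else 0)"
    using w0 unfolding W_def by auto
  ultimately have "unit_count G + unit_count E \<le> unit_count F + 2 * card (\<Union>G \<inter> \<Union>E)"
    using le unfolding unit_count_def by linarith
  then show thesis using that G E cF n by blast
qed

section \<open>Two partitions of one region into two subcubes\<close>

text \<open>Inside \<open>K1\<close> or \<open>K2\<close> the literal \<open>y\<close> can be made
  false, which rules out \<open>L1\<close> and forces \<open>L2\<close>; so every literal of
  \<open>L2\<close> except \<open>- y\<close> is already in both. Without \<open>- y\<close>, the
  subcube of \<open>L2\<close> would cover that of \<open>L1\<close>, against disjointness.\<close>

lemma two_cubes_missing_literal:
  assumes cl: "is_clause K1" "is_clause K2" "is_clause L1" "is_clause L2"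
    and eqv: "\<forall>S. assignment S \<longrightarrow> (K1 \<subseteq> S \<or> K2 \<subseteq> S \<longleftrightarrow> L1 \<subseteq> S \<or> L2 \<subseteq> S)"
    and disj: "\<forall>S. assignment S \<longrightarrow> \<not> (L1 \<subseteq> S \<and> L2 \<subseteq> S)"
    and y: "y \<in> L1" "y \<notin> K1" "y \<notin> K2"
  shows "- y \<in> L2" "L2 - {- y} \<subseteq> K1 \<inter> K2"
proof -
  have sub: "z \<in> K" if K: "K = K1 \<or> K = K2" and z: "z \<in> L2" "z \<noteq> - y" for K z
  proof (rule ccontr)
    assume zK: "z \<notin> K"
    have clK: "is_clause K" and yK: "y \<notin> K" using K cl y by auto
    have nz: "y \<noteq> 0" "z \<noteq> 0" using cl y z unfolding is_clause_def by auto
    have "0 \<notin> K \<union> {- y, - z}" using clK nz unfolding is_clause_def by auto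
    moreover have "- x \<notin> K \<union> {- y, - z}" if "x \<in> K \<union> {- y, - z}" for x
      using that clK yK zK nz z(2) unfolding is_clause_def by auto
    ultimately obtain S where S: "assignment S" "K \<union> {- y, - z} \<subseteq> S"
      using assignment_extending by metis
    then have "L1 \<subseteq> S \<or> L2 \<subseteq> S" using eqv K by blast
    then have "y \<in> S \<or> z \<in> S" using y z by blast
    then show False using S nz unfolding assignment_def by blast
  qed
  then show s: "L2 - {- y} \<subseteq> K1 \<inter> K2" by blast
  show "- y \<in> L2"
  proof (rule ccontr)
    assume "- y \<notin> L2"
    then have "L2 \<subseteq> K1 \<inter> K2" using s by blast
    moreover obtain S where "assignment S" "L1 \<subseteq> S" using clause_extending[OF cl(3)] by blast
    ultimately show False using eqv disj by blast
  qed
qed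

text \<open>\<open>B\<close> holds the literals foreign to \<open>K1\<close> and \<open>K2\<close>.
  Each of \<open>L1\<close>, \<open>L2\<close> has at most one; if both have one, these are
  complementary and all other literals lie in \<open>K1 \<inter> K2\<close>.\<close>

lemma two_cubes_lits:
  assumes cl: "is_clause K1" "is_clause K2" "is_clause L1" "is_clause L2"
    and eqv: "\<forall>S. assignment S \<longrightarrow> (K1 \<subseteq> S \<or> K2 \<subseteq> S \<longleftrightarrow> L1 \<subseteq> S \<or> L2 \<subseteq> S)"
    and disj: "\<forall>S. assignment S \<longrightarrow> \<not> (L1 \<subseteq> S \<and> L2 \<subseteq> S)"
  defines "B \<equiv> (L1 \<union> L2) - (K1 \<union> K2)"
  shows "card B \<le> 1 \<or> card B \<le> 2 \<and> (L1 \<union> L2) \<inter> (K1 \<union> K2) \<subseteq> K1 \<inter> K2"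
proof -
  note m1 = two_cubes_missing_literal[OF cl eqv disj]
  have m2: "- y \<in> L1" "L1 - {- y} \<subseteq> K1 \<inter> K2" if "y \<in> L2" "y \<notin> K1" "y \<notin> K2" for y
  proof -
    have "\<forall>S. assignment S \<longrightarrow> (K1 \<subseteq> S \<or> K2 \<subseteq> S \<longleftrightarrow> L2 \<subseteq> S \<or> L1 \<subseteq> S)"
      "\<forall>S. assignment S \<longrightarrow> \<not> (L2 \<subseteq> S \<and> L1 \<subseteq> S)"
      using eqv disj by auto
    from two_cubes_missing_literal[OF cl(1,2,4,3) this that]
    show "- y \<in> L1" "L1 - {- y} \<subseteq> K1 \<inter> K2" .
  qed
  \<comment> \<open>Two distinct foreign literals in \<open>L1\<close> would place all of
    \<open>L2\<close> in \<open>K1 \<inter> K2\<close>, since no literal equals both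
    \<open>- y\<close> and \<open>- z\<close>.\<close>
  have L1: "y = z" if "y \<in> B \<inter> L1" "z \<in> B \<inter> L1" for y z
  proof (rule ccontr)
    assume "y \<noteq> z"
    then have "- y \<noteq> - z" by simp
    moreover have "L2 - {- y} \<subseteq> K1 \<inter> K2" "L2 - {- z} \<subseteq> K1 \<inter> K2"
      using m1(2) that unfolding B_def by blast+
    ultimately have "L2 \<subseteq> K1 \<inter> K2" by blast
    moreover obtain S where "assignment S" "L1 \<subseteq> S" using clause_extending[OF cl(3)] by blast
    ultimately show False using eqv disj by blast
  qed
  have L2: "y = z" if "y \<in> B \<inter> L2" "z \<in> B \<inter> L2" for y z
  proof (rule ccontr)
    assume "y \<noteq> z"
    then have "- y \<noteq> - z" by simp
    moreover have "L1 - {- y} \<subseteq> K1 \<inter> K2" "L1 - {- z} \<subseteq> K1 \<inter> K2"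
      using m2(2) that unfolding B_def by blast+
    ultimately have "L1 \<subseteq> K1 \<inter> K2" by blast
    moreover obtain S where "assignment S" "L2 \<subseteq> S" using clause_extending[OF cl(4)] by blast
    ultimately show False using eqv disj by blast
  qed
  have fin: "finite B" using cl unfolding B_def is_clause_def by auto
  show ?thesis
  proof (cases "B \<inter> L1 = {} \<or> B \<inter> L2 = {}")
    case True
    then have "y = z" if "y \<in> B" "z \<in> B" for y z
      using that L1 L2 unfolding B_def by blast
    then have "card B \<le> 1" using card_le_Suc0_iff_eq[OF fin] by simp
    then show ?thesis ..
  next
    case False
    then obtain y z where y: "y \<in> B \<inter> L1" and z: "z \<in> B \<inter> L2" by blast
    have "B = {y, z}" using y z L1 L2 unfolding B_def by blast
    then have "card B \<le> 2" by (simp add: card_insert_if)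
    moreover have "L2 - {- y} \<subseteq> K1 \<inter> K2" "L1 - {- z} \<subseteq> K1 \<inter> K2"
      using m1(2)[of y] m2(2)[of z] y z unfolding B_def by auto
    moreover from this have "y = - z" using y unfolding B_def by auto
    ultimately have "card B \<le> 2 \<and> (L1 \<union> L2) \<inter> (K1 \<union> K2) \<subseteq> K1 \<inter> K2"
      using y z unfolding B_def by auto
    then show ?thesis ..
  qed
qed

section \<open>Degree-1 literals created by a split\<close>

text \<open>With \<open>x\<close> projected away, the clauses with \<open>x\<close> and those with
  \<open>- x\<close> cover the same region: the assignments whose clause changes when
  \<open>x\<close> is flipped. By \<open>same_side_cubes\<close>, each side covers it without
  overlap.\<close>

lemma opposite_cubes:
  assumes F: "uhit F" and S: "assignment S" and C: "C \<in> F" "x \<in> C" "C - {x} \<subseteq> S"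
  obtains D where "D \<in> F" "- x \<in> D" "D - {- x} \<subseteq> S"
proof -
  have x0: "x \<noteq> 0" using uhit_lits_nonzero[OF F] C by blast
  have S': "assignment (S - uminus ` {x} \<union> {x})"
    using assignment_override[OF S is_clause_singleton[OF x0]] .
  have "- x \<notin> C" using uhit_clause[OF F C(1)] C(2) unfolding is_clause_def by blast
  then have "C \<subseteq> S - uminus ` {x} \<union> {x}" using C by auto
  then obtain D where "D \<in> F" "- x \<in> D" "D \<subseteq> insert (- x) (S - uminus ` {x} \<union> {x} - {x})"
    using uhit_flip[OF F S' C(1,2)] by blast
  then show thesis using that by blast
qed

lemma same_side_cubes:
  assumes F: "uhit F" and S: "assignment S"
    and C: "C \<in> F" "x \<in> C" "C - {x} \<subseteq> S" and D: "D \<in> F" "x \<in> D" "D - {x} \<subseteq> S"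
  shows "C = D"
proof -
  have x0: "x \<noteq> 0" using uhit_lits_nonzero[OF F] C by blast
  have S': "assignment (S - uminus ` {x} \<union> {x})"
    using assignment_override[OF S is_clause_singleton[OF x0]] .
  have "- x \<notin> C" "- x \<notin> D"
    using uhit_clause[OF F] C D unfolding is_clause_def by blast+
  then show ?thesis using uhit_unique[OF F S' C(1) D(1)] C D by auto
qed

text \<open>The restriction deletes only clauses with \<open>- x\<close>, so a literal whose degree
  dropped to 1 must occur in one of these.\<close>

lemma unit_lits_restr_singleton:
  assumes F: "uhit F" and x: "x \<noteq> 0" and y: "y \<in> unit_lits (restr {x} F)" "ldeg F y \<noteq> 1"
  shows "y \<noteq> x" "y \<noteq> - x" "\<exists>D\<in>F. - x \<in> D \<and> y \<in> D"
proof -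
  have R: "uhit (restr {x} F)" using uhit_restr(1)[OF F is_clause_singleton[OF x]] .
  have "y \<in> \<Union>(restr {x} F)" using unit_lits_subset[OF R] y by blast
  then show yx: "y \<noteq> x" "y \<noteq> - x" using restr_lits[of "{x}" F] by auto
  show "\<exists>D\<in>F. - x \<in> D \<and> y \<in> D"
  proof (rule ccontr)
    assume "\<not> ?thesis"
    then have "{C \<in> F. - x \<notin> C \<and> y \<in> C} = {C \<in> F. y \<in> C}" by blast
    then show False
      using y ldeg_restr[OF F is_clause_singleton[OF x], of y] yx
      unfolding unit_lits_def compatible_singleton ldeg_def by simp
  qed
qed

text \<open>All degree-1 literals of the half lie in \<open>L1 \<union> L2\<close>. Either there is
  one each from \<open>K1\<close>, \<open>K2\<close> and \<open>B\<close>, at most, or literals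
  shared with \<open>K1 \<union> K2\<close> lie in both clauses, hence have degree at least 2, and
  only the at most two of \<open>B\<close> remain.\<close>

lemma card_unit_lits_restr_2_2:
  assumes F: "uhit F" and ns: "\<And>y. ldeg F y \<noteq> 1"
    and deg: "ldeg F x = 2" "ldeg F (- x) = 2"
  shows "card (unit_lits (restr {x} F)) \<le> 3"
proof -
  have x: "x \<noteq> 0" using uhit_lits_nonzero[OF F] uhit_ldeg_pos_iff[OF F, of x] deg by simp
  obtain P1 P2 where P: "{C \<in> F. x \<in> C} = {P1, P2}" "P1 \<noteq> P2"
    using deg(1) unfolding ldeg_def card_2_iff by blast
  obtain Q1 Q2 where Q: "{C \<in> F. - x \<in> C} = {Q1, Q2}" "Q1 \<noteq> Q2"
    using deg(2) unfolding ldeg_def card_2_iff by blast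
  have PF: "P1 \<in> F" "x \<in> P1" "P2 \<in> F" "x \<in> P2" and QF: "Q1 \<in> F" "- x \<in> Q1" "Q2 \<in> F" "- x \<in> Q2"
    using P Q by blast+
  define K1 K2 L1 L2 where "K1 = P1 - {x}" and "K2 = P2 - {x}" and "L1 = Q1 - {- x}" and "L2 = Q2 - {- x}"
  note KL = K1_def K2_def L1_def L2_def
  define R where "R = restr {x} F"
  have R: "uhit R" unfolding R_def using uhit_restr(1)[OF F is_clause_singleton[OF x]] .
  have cl: "is_clause K1" "is_clause K2" "is_clause L1" "is_clause L2"
    using is_clause_subset[OF uhit_clause[OF F]] PF QF unfolding KL by blast+
  have eqv: "\<forall>S. assignment S \<longrightarrow> (K1 \<subseteq> S \<or> K2 \<subseteq> S \<longleftrightarrow> L1 \<subseteq> S \<or> L2 \<subseteq> S)"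
  proof (intro allI impI iffI)
    fix S assume S: "assignment S"
    assume "K1 \<subseteq> S \<or> K2 \<subseteq> S"
    then obtain C where "C \<in> F" "x \<in> C" "C - {x} \<subseteq> S" using PF unfolding KL by blast
    then obtain D where "D \<in> F" "- x \<in> D" "D - {- x} \<subseteq> S" using opposite_cubes[OF F S] by blast
    then show "L1 \<subseteq> S \<or> L2 \<subseteq> S" using Q unfolding KL by blast
  next
    fix S assume S: "assignment S"
    assume "L1 \<subseteq> S \<or> L2 \<subseteq> S"
    then obtain C where "C \<in> F" "- x \<in> C" "C - {- x} \<subseteq> S" using QF unfolding KL by blast
    then obtain D where "D \<in> F" "x \<in> D" "D - {x} \<subseteq> S"
      using opposite_cubes[OF F S, of C "- x"] by auto
    then show "K1 \<subseteq> S \<or> K2 \<subseteq> S" using P unfolding KL by blast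
  qed
  have disj: "\<forall>S. assignment S \<longrightarrow> \<not> (L1 \<subseteq> S \<and> L2 \<subseteq> S)"
    using same_side_cubes[OF F _ QF(1,2) _ QF(3,4)] Q(2) unfolding KL by blast
  have nx: "- x \<notin> P1" "- x \<notin> P2" using uhit_clause[OF F] PF unfolding is_clause_def by blast+
  have KR: "K1 \<in> R" "K2 \<in> R"
    using PF nx unfolding R_def restr_def compatible_singleton KL by blast+
  have Kne: "K1 \<noteq> K2" using P(2) PF unfolding KL by blast
  define U where "U = unit_lits R"
  have fU: "finite U" unfolding U_def using finite_unit_lits[OF R] .
  have UL: "U \<subseteq> L1 \<union> L2"
  proof
    fix y assume "y \<in> U"
    then have "y \<noteq> - x" "\<exists>D\<in>F. - x \<in> D \<and> y \<in> D"
      using unit_lits_restr_singleton[OF F x _ ns] unfolding U_def R_def by blast+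
    then show "y \<in> L1 \<union> L2" using Q unfolding KL by blast
  qed
  have UK: "U \<inter> (K1 \<inter> K2) = {}"
    using unit_clause_unique[OF _ KR(1) _ KR(2)] Kne unfolding U_def unit_lits_def by blast
  have U1: "card (U \<inter> K1) \<le> 1" "card (U \<inter> K2) \<le> 1"
    using card_unit_lits_clause[OF R] KR unfolding U_def by auto
  define B where "B = (L1 \<union> L2) - (K1 \<union> K2)"
  have fB: "finite B" using cl unfolding B_def is_clause_def by auto
  have "card U \<le> 3"
    using two_cubes_lits[OF cl eqv disj, folded B_def]
  proof (elim disjE conjE)
    assume B: "card B \<le> 1"
    have "U \<subseteq> (U \<inter> K1) \<union> (U \<inter> K2) \<union> B" using UL unfolding B_def by blast
    then have "card U \<le> card ((U \<inter> K1) \<union> (U \<inter> K2) \<union> B)" using fU fB by (intro card_mono) auto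
    then show ?thesis
      using B U1 card_Un_le[of "(U \<inter> K1) \<union> (U \<inter> K2)" B] card_Un_le[of "U \<inter> K1" "U \<inter> K2"] by linarith
  next
    assume B: "card B \<le> 2" and s: "(L1 \<union> L2) \<inter> (K1 \<union> K2) \<subseteq> K1 \<inter> K2"
    have "U \<subseteq> B" using UL UK s unfolding B_def by blast
    then show ?thesis using card_mono[OF fB, of U] B by linarith
  qed
  then show ?thesis unfolding U_def R_def .
qed

text \<open>The three clauses with \<open>x\<close> partition the region of the two subcubes
  \<open>Q1\<close>, \<open>Q2\<close> projected along \<open>x\<close>. Each of \<open>Q1\<close>,
  \<open>Q2\<close> contains at most one degree-1 literal of the half; the others, \<open>B\<close>,
  appear in the partitions \<open>M Q1\<close>, \<open>M Q2\<close> induced on the two subcubes,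
  whose few clauses leave at most 4 literals.\<close>

lemma card_unit_lits_restr_3_2:
  assumes F: "uhit F" and ns: "\<And>y. ldeg F y \<noteq> 1"
    and deg: "ldeg F x = 3" "ldeg F (- x) = 2"
  shows "card (unit_lits (restr {- x} F)) \<le> 6"
proof -
  have x: "x \<noteq> 0" using uhit_lits_nonzero[OF F] uhit_ldeg_pos_iff[OF F, of x] deg by simp
  define P where "P = {C \<in> F. x \<in> C}"
  have cP: "card P = 3" "finite P" using deg uhit_finite[OF F] unfolding P_def ldeg_def by auto
  obtain Q1 Q2 where Q: "{C \<in> F. - x \<in> C} = {Q1, Q2}" "Q1 \<noteq> Q2"
    using deg(2) unfolding ldeg_def card_2_iff by blast
  have QF: "Q1 \<in> F" "- x \<in> Q1" "Q2 \<in> F" "- x \<in> Q2" using Q by blast+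
  \<comment> \<open>\<open>A Q\<close> is the subcube of \<open>Q\<close> moved to the side
    \<open>x\<close>; only clauses of \<open>P\<close> meet it.\<close>
  define A where "A Q = insert x (Q - {- x})" for Q
  define M where "M Q = restr (A Q) F" for Q
  define R where "R = restr {- x} F"
  define U where "U = unit_lits R"
  have R: "uhit R" unfolding R_def using uhit_restr(1)[OF F is_clause_singleton] x by simp
  have clA: "is_clause (A Q)" if "Q \<in> F" "- x \<in> Q" for Q
    using uhit_clause[OF F that(1)] x that unfolding is_clause_def A_def by (auto simp: minus_equation_iff)
  have compP: "{C \<in> F. compatible (A Q) C} \<subseteq> P" if Q: "Q \<in> F" "- x \<in> Q" for Q
  proof
    fix C assume "C \<in> {C \<in> F. compatible (A Q) C}"
    then have C: "C \<in> F" and c: "\<And>z. z \<in> A Q \<Longrightarrow> - z \<notin> C" unfolding compatible_def by auto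
    have "- x \<notin> C" using c[of x] unfolding A_def by simp
    then obtain z where z: "z \<in> Q" "- z \<in> C" using uhit_clash[OF F Q(1) C] Q by blast
    then have "z = - x" using c[of z] unfolding A_def by auto
    then show "C \<in> P" using z C unfolding P_def by simp
  qed
  have M: "uhit (M Q)" "card (M Q) = card {C \<in> F. compatible (A Q) C}" if "Q \<in> F" "- x \<in> Q" for Q
    unfolding M_def using uhit_restr(1)[OF F clA[OF that]] card_restr[OF F clA[OF that]] by auto
  have lM: "card (\<Union>(M Q)) + 2 \<le> 2 * card (M Q)" if "Q \<in> F" "- x \<in> Q" for Q
    using num_vars_less_card[OF M(1)[OF that]] card_lits[OF M(1)[OF that]] by simp
  have M3: "card (M Q) \<le> 3" if "Q \<in> F" "- x \<in> Q" for Q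
    using card_mono[OF cP(2) compP[OF that]] cP(1) M(2)[OF that] by simp
  have UP: "y \<noteq> x \<and> y \<noteq> - x \<and> (\<exists>C\<in>P. y \<in> C)" if "y \<in> U" for y
    using unit_lits_restr_singleton[OF F _ _ ns, of "- x" y] x that unfolding U_def R_def P_def by auto
  define B where "B = U - (Q1 \<union> Q2)"
  have BM: "y \<in> \<Union>(M Q)" if "y \<in> B" "Q = Q1 \<or> Q = Q2" "C \<in> P" "y \<in> C" "compatible (A Q) C" for y Q C
  proof -
    have "y \<notin> A Q" using that UP unfolding A_def B_def by blast
    then show ?thesis using that unfolding M_def restr_def P_def by blast
  qed
  have comp: "compatible (A Q1) C \<or> compatible (A Q2) C" if C: "C \<in> P" for C
  proof -
    have CF: "C \<in> F" "x \<in> C" using C unfolding P_def by auto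
    obtain S where S: "assignment S" "C \<subseteq> S" using clause_extending[OF uhit_clause[OF F CF(1)]] by blast
    obtain D where D: "D \<in> F" "- x \<in> D" "D \<subseteq> insert (- x) (S - {x})"
      using uhit_flip[OF F S(1) CF S(2)] by blast
    have "compatible (A D) C" unfolding compatible_def
    proof
      fix z assume "z \<in> A D"
      then have z: "z \<in> S" using D S CF unfolding A_def by auto
      have "z \<noteq> 0" using \<open>z \<in> A D\<close> clA[OF D(1,2)] unfolding is_clause_def by auto
      then show "- z \<notin> C" using z S unfolding assignment_def by blast
    qed
    moreover have "D \<in> {Q1, Q2}" using D(1,2) Q(1) by blast
    ultimately show ?thesis by auto
  qed
  have fM: "finite (\<Union>(M Q1))" "finite (\<Union>(M Q2))" using uhit_lits_finite M QF by blast+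
  \<comment> \<open>If all three clauses of \<open>P\<close> meet one of the subcubes, the partition
    induced there has at most two variables and already shows every literal of
    \<open>B\<close>.\<close>
  have full: "card B \<le> 4" if Q': "Q = Q1 \<or> Q = Q2" and 3: "card (M Q) = 3" for Q
  proof -
    have QQ: "Q \<in> F" "- x \<in> Q" using Q' QF by auto
    have "{C \<in> F. compatible (A Q) C} = P"
      using card_subset_eq[OF cP(2) compP[OF QQ]] cP(1) M(2)[OF QQ] 3 by simp
    then have "B \<subseteq> \<Union>(M Q)"
      using UP BM[OF _ Q'] unfolding B_def by blast
    then show ?thesis using card_mono[of "\<Union>(M Q)" B] lM[OF QQ] 3 fM Q' by auto
  qed
  have B4: "card B \<le> 4"
  proof (cases "card (M Q1) = 3 \<or> card (M Q2) = 3")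
    case True then show ?thesis using full by blast
  next
    case False
    then have m: "card (M Q1) \<le> 2" "card (M Q2) \<le> 2" using M3[OF QF(1,2)] M3[OF QF(3,4)] by auto
    \<comment> \<open>Otherwise each induced partition has at most two clauses, hence at most one
      variable, and the two together supply at most 2 + 2 literals.\<close>
    have "B \<subseteq> \<Union>(M Q1) \<union> \<Union>(M Q2)"
    proof
      fix y assume y: "y \<in> B"
      then obtain C where C: "C \<in> P" "y \<in> C" using UP unfolding B_def by blast
      show "y \<in> \<Union>(M Q1) \<union> \<Union>(M Q2)"
        using comp[OF C(1)] BM[OF y _ C, of Q1] BM[OF y _ C, of Q2] by (auto simp del: Union_iff)
    qed
    then have "card B \<le> card (\<Union>(M Q1) \<union> \<Union>(M Q2))" using fM by (intro card_mono) auto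
    also have "\<dots> \<le> card (\<Union>(M Q1)) + card (\<Union>(M Q2))" by (rule card_Un_le)
    also have "\<dots> \<le> 4" using lM[OF QF(1,2)] lM[OF QF(3,4)] m by linarith
    finally show ?thesis .
  qed
  have UQ: "card (U \<inter> Q) \<le> 1" if "Q \<in> F" "- x \<in> Q" for Q
  proof -
    have "x \<notin> Q" using uhit_clause[OF F that(1)] that(2) unfolding is_clause_def by blast
    then have "Q - {- x} \<in> R" using that unfolding R_def restr_def compatible_singleton by auto
    moreover have "U \<inter> Q = U \<inter> (Q - {- x})" using UP by blast
    ultimately show ?thesis using card_unit_lits_clause[OF R] unfolding U_def by simp
  qed
  have "U = (U \<inter> Q1) \<union> (U \<inter> Q2) \<union> B" unfolding B_def by blast
  then have "card U \<le> card (U \<inter> Q1) + card (U \<inter> Q2) + card B"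
    using card_Un_le[of "(U \<inter> Q1) \<union> (U \<inter> Q2)" B] card_Un_le[of "U \<inter> Q1" "U \<inter> Q2"] by simp
  then have "card U \<le> 6" using B4 UQ[OF QF(1,2)] UQ[OF QF(3,4)] by linarith
  then show ?thesis unfolding U_def R_def .
qed

lemma unit_lits_pigeonhole:
  assumes F: "uhit F" and "num_vars F < card (unit_lits F)"
  obtains y where "y \<in> unit_lits F" "- y \<in> unit_lits F"
proof (rule ccontr)
  assume n: "\<not> thesis"
  have "unit_lits F \<inter> uminus ` unit_lits F = {}" using that n by force
  then have "card (unit_lits F \<union> uminus ` unit_lits F) = 2 * card (unit_lits F)"
    using finite_unit_lits[OF F] by (simp add: card_Un_disjoint card_image)
  moreover have "unit_lits F \<union> uminus ` unit_lits F \<subseteq> \<Union>F"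
    using unit_lits_subset[OF F] uhit_lits_uminus[OF F] by blast
  ultimately have "2 * card (unit_lits F) \<le> card (\<Union>F)"
    using card_mono[OF uhit_lits_finite[OF F]] by metis
  then show False using assms(2) card_lits[OF F] by simp
qed

text \<open>Outside the clauses with \<open>- x\<close>, each of \<open>y\<close> and
  \<open>- y\<close> occurs once; no clause with \<open>- x\<close> contains both, so these
  contribute at most \<open>ldeg F (- x)\<close>.\<close>

lemma unit_restr_degree:
  assumes F: "uhit F" and x: "x \<noteq> 0"
    and y: "y \<in> unit_lits (restr {x} F)" "- y \<in> unit_lits (restr {x} F)"
  shows "ldeg F y + ldeg F (- y) \<le> 2 + ldeg F (- x)"
proof -
  have R: "uhit (restr {x} F)" using uhit_restr(1)[OF F is_clause_singleton[OF x]] .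
  have one: "card {C \<in> F. - x \<notin> C \<and> z \<in> C} = 1" if z: "z \<in> unit_lits (restr {x} F)" for z
  proof -
    have "z \<in> \<Union>(restr {x} F)" using unit_lits_subset[OF R] z by blast
    then have "z \<notin> {x}" using restr_lits[of "{x}" F] by blast
    then show ?thesis
      using z ldeg_restr[OF F is_clause_singleton[OF x], of z]
      unfolding unit_lits_def compatible_singleton by simp
  qed
  have "card {C \<in> F. - x \<in> C \<and> y \<in> C} + card {C \<in> F. - x \<in> C \<and> - y \<in> C}
      = card ({C \<in> F. - x \<in> C \<and> y \<in> C} \<union> {C \<in> F. - x \<in> C \<and> - y \<in> C})"
    using uhit_finite[OF F] uhit_clause[OF F]
    by (subst card_Un_disjoint) (auto simp: is_clause_def)
  also have "\<dots> \<le> ldeg F (- x)"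
    unfolding ldeg_def using uhit_finite[OF F] by (intro card_mono) auto
  finally show ?thesis
    using one[OF y(1)] one[OF y(2)] ldeg_split[OF uhit_finite[OF F], of y x]
      ldeg_split[OF uhit_finite[OF F], of "- y" x] by linarith
qed

section \<open>The main inequality\<close>

text \<open>This is \<open>n \<le> 4 * (c - n) - 5 + u\<close>, rearranged to avoid subtraction of
  natural numbers.\<close>

lemma num_vars_bound:
  "uhit F \<Longrightarrow> card F \<le> num_vars F + 3 \<Longrightarrow> 5 * num_vars F + 5 \<le> 4 * card F + unit_count F"
proof (induction "num_vars F" arbitrary: F rule: less_induct)
  case less
  note F = less.prems(1)
  consider (empty) "\<Union>F = {}" | (singular) w where "ldeg F w = 1"
    | (nonsingular) "\<Union>F \<noteq> {}" "\<And>y. ldeg F y \<noteq> 1" by blast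
  then show ?case
  proof cases
    case empty
    then have "F = {{}}" using no_lits_uhit F by blast
    then show ?thesis by (simp add: num_vars_def vars_def unit_count_def)
  next
    case singular
    obtain G E where G: "uhit G" and E: "uhit E" and c: "card F = card G + card E"
      and n: "2 * num_vars F + card (\<Union>G \<inter> \<Union>E) = 2 * num_vars G + 2 * num_vars E + 2"
      and u: "unit_count G + unit_count E \<le> unit_count F + 2 * card (\<Union>G \<inter> \<Union>E)"
      using singular_decomposition[OF F singular] by blast
    have t: "num_vars G < card G" "num_vars E < card E"
      using num_vars_less_card G E by auto
    have "card (\<Union>G \<inter> \<Union>E) \<le> card (\<Union>G)" "card (\<Union>G \<inter> \<Union>E) \<le> card (\<Union>E)"
      using uhit_lits_finite[OF G] uhit_lits_finite[OF E] by (auto intro: card_mono)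
    \<comment> \<open>Hence both parts have fewer variables than \<open>F\<close>. Their values of
      \<open>c - n\<close> are at least 1 and add up to at most
      \<open>card F - num_vars F + 1\<close>, so neither exceeds 3.\<close>
    then have s: "card (\<Union>G \<inter> \<Union>E) \<le> 2 * num_vars G" "card (\<Union>G \<inter> \<Union>E) \<le> 2 * num_vars E"
      using card_lits G E by auto
    have "5 * num_vars G + 5 \<le> 4 * card G + unit_count G"
      using less.hyps[OF _ G] n c s t less.prems(2) by linarith
    moreover have "5 * num_vars E + 5 \<le> 4 * card E + unit_count E"
      using less.hyps[OF _ E] n c s t less.prems(2) by linarith
    \<comment> \<open>A common literal costs 2 in the bound \<open>u\<close>, but lowers
      \<open>5 * num_vars F\<close> by 5/2.\<close>
    ultimately show ?thesis using n c u by linarith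
  next
    case nonsingular
    obtain x where x: "x \<in> \<Union>F"
      and min: "\<And>y. y \<in> \<Union>F \<Longrightarrow> ldeg F x + ldeg F (- x) \<le> ldeg F y + ldeg F (- y)"
      using min_degree_literal[OF F nonsingular(1)] by blast
    have restr: "uhit (restr {z} F)" "num_vars (restr {z} F) + 1 = num_vars F"
      "card (restr {z} F) + ldeg F (- z) = card F" "ldeg F z \<ge> 2"
      "ldeg F (- z) + num_vars F \<le> card F"
      "card (restr {z} F) \<le> num_vars (restr {z} F) + 3"
      "5 * num_vars F \<le> 4 * card (restr {z} F) + card (unit_lits (restr {z} F))"
      if z: "z = x \<or> z = - x" for z
    proof -
      have zF: "z \<in> \<Union>F" using z x uhit_lits_uminus[OF F] by blast
      have zmin: "ldeg F z + ldeg F (- z) \<le> ldeg F y + ldeg F (- y)" if "y \<in> \<Union>F" for y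
        using min[OF that] z by auto
      have pos: "ldeg F y \<ge> 2" if "y \<in> \<Union>F" for y
        using uhit_ldeg_pos_iff[OF F, of y] nonsingular(2)[of y] that by linarith
      show R: "uhit (restr {z} F)"
        using uhit_restr(1)[OF F is_clause_singleton[OF uhit_lits_nonzero[OF F zF]]] .
      show n: "num_vars (restr {z} F) + 1 = num_vars F"
        using num_vars_restr_min_degree[OF F zF zmin] .
      show c: "card (restr {z} F) + ldeg F (- z) = card F" using card_restr_singleton[OF F zF] .
      show "ldeg F z \<ge> 2" using pos[OF zF] .
      show d: "ldeg F (- z) + num_vars F \<le> card F" using num_vars_less_card[OF R] n c by linarith
      have p: "ldeg F (- z) \<ge> 2" using pos uhit_lits_uminus[OF F zF] by blast
      show c3: "card (restr {z} F) \<le> num_vars (restr {z} F) + 3"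
        using n c p less.prems(2) by linarith
      have "5 * num_vars (restr {z} F) + 5 \<le> 4 * card (restr {z} F) + unit_count (restr {z} F)"
        using less.hyps[OF _ R c3] n by linarith
      \<comment> \<open>This removes the extra summand of \<open>unit_count\<close>: a half
        \<open>{{}}\<close> would give \<open>card F = 1 + ldeg F (- z)\<close>, whereas at least
        two further clauses contain \<open>z\<close>.\<close>
      moreover have "restr {z} F \<noteq> {{}}"
      proof
        assume e: "restr {z} F = {{}}"
        then have "num_vars F = 1" "card F = 1 + ldeg F (- z)"
          using n c by (simp_all add: num_vars_def vars_def)
        moreover have "ldeg F z + ldeg F (- z) \<le> card F"
        proof -
          have "ldeg F z + ldeg F (- z) = card ({C \<in> F. z \<in> C} \<union> {C \<in> F. - z \<in> C})"
            unfolding ldeg_def using uhit_finite[OF F] uhit_clause[OF F]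
            by (subst card_Un_disjoint) (auto simp: is_clause_def)
          also have "\<dots> \<le> card F" using uhit_finite[OF F] by (intro card_mono) auto
          finally show ?thesis .
        qed
        ultimately show False using pos[OF zF] by linarith
      qed
      ultimately show "5 * num_vars F \<le> 4 * card (restr {z} F) + card (unit_lits (restr {z} F))"
        using n unfolding unit_count_def by simp
    qed
    note rx = restr[of x, simplified] and rmx = restr[of "- x", simplified]
    have x0: "x \<noteq> 0" using uhit_lits_nonzero[OF F x] .
    have "ldeg F x \<le> 3" "ldeg F (- x) \<le> 3" using rx(5) rmx(5) less.prems(2) by linarith+
    then consider "ldeg F x = 2" "ldeg F (- x) = 2" | "ldeg F x = 3" "ldeg F (- x) = 2"
      | "ldeg F x = 2" "ldeg F (- x) = 3" | "ldeg F x = 3" "ldeg F (- x) = 3"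
      using rx(4) rmx(4) by linarith
    then have "5 * num_vars F + 5 \<le> 4 * card F"
    proof cases
      \<comment> \<open>The half has \<open>c - 2\<close> clauses, and
        \<open>4 * (c - 2) + 3 = 4 * c - 5\<close>.\<close>
      case 1
      then show ?thesis
        using card_unit_lits_restr_2_2[OF F nonsingular(2)] rx(3,7) by fastforce
    next
      \<comment> \<open>The half that loses three clauses is used, and
        \<open>4 * (c - 3) + 6 < 4 * c - 5\<close>.\<close>
      case 2
      then show ?thesis
        using card_unit_lits_restr_3_2[OF F nonsingular(2)] rmx(3,7) by fastforce
    next
      case 3
      then show ?thesis
        using card_unit_lits_restr_3_2[OF F nonsingular(2), of "- x"] rx(3,7) by simp
    next
      \<comment> \<open>From \<open>5 * n \<le> 4 * (c - 3) + u\<close> and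
        \<open>c \<le> n + 3\<close> follows \<open>n \<le> u\<close>, while the half has only
        \<open>n - 1\<close> variables. So some \<open>y\<close> and \<open>- y\<close> both have
        degree 1 there, and the degree of \<open>y\<close> in \<open>F\<close> is at most 2 + 3,
        below the minimum 3 + 3.\<close>
      case 4
      then have "num_vars (restr {x} F) < card (unit_lits (restr {x} F))"
        using rx(2,3,7) less.prems(2) by linarith
      then obtain y where y: "y \<in> unit_lits (restr {x} F)" "- y \<in> unit_lits (restr {x} F)"
        using unit_lits_pigeonhole[OF rx(1)] by blast
      have "y \<in> \<Union>F" using unit_lits_subset[OF rx(1)] y restr_lits[of "{x}" F] by blast
      then show ?thesis using min[of y] unit_restr_degree[OF F x0 y] 4 by linarith
    qed
    then show ?thesis by linarith
  qed
qed

section \<open>Transfer to unsatisfiable hitting clause-sets\<close>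

lemma uhitI:
  assumes F: "is_clause_set F" "\<not> satisfiable F" "hitting F"
  shows "uhit F"
  unfolding uhit_def
proof (intro conjI allI impI)
  fix S assume S: "assignment S"
  have nz: "x \<noteq> 0" if "x \<in> \<Union>F" for x
    using that F(1) unfolding is_clause_set_def is_clause_def by blast
  have fin: "finite (\<Union>F)" using F(1) unfolding is_clause_set_def is_clause_def by blast
  \<comment> \<open>The literals of \<open>F\<close> outside \<open>S\<close> form a finite clause.
    Being no satisfying one, it misses some \<open>C\<close>, which then lies inside
    \<open>S\<close>.\<close>
  define T where "T = {x \<in> \<Union>F. x \<notin> S}"
  have "is_clause T"
    unfolding is_clause_def
  proof (intro conjI notI)
    show "finite T" by (rule finite_subset[OF _ fin]) (auto simp: T_def)
    show False if "0 \<in> T" using that nz unfolding T_def by blast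
    assume "\<exists>x. x \<in> T \<and> - x \<in> T"
    then obtain x where "x \<in> \<Union>F" "x \<notin> S" "- x \<notin> S" unfolding T_def by blast
    then show False using nz[of x] S unfolding assignment_def by blast
  qed
  then obtain C where C: "C \<in> F" "T \<inter> C = {}" using F(2) unfolding satisfiable_def by blast
  then have CS: "C \<subseteq> S" unfolding T_def by blast
  have "D = C" if D: "D \<in> F" "D \<subseteq> S" for D
  proof (rule ccontr)
    assume "D \<noteq> C"
    then obtain x where x: "x \<in> D" "- x \<in> C" using F(3) C(1) D(1) unfolding hitting_def by blast
    then have "x \<in> S" "- x \<in> S" "x \<noteq> 0" using D CS nz by blast+
    then show False using S unfolding assignment_def by blast
  qed
  then show "\<exists>!C. C \<in> F \<and> C \<subseteq> S" using C CS by blast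
qed (rule F(1))

text \<open>The complement of an occurring literal occurs too, so a literal of degree 1 of either
  sign attains the minimum in the definition of a singular variable.\<close>

lemma nonsingular_ldeg:
  assumes F: "uhit F" and ns: "nonsingular F"
  shows "ldeg F y \<noteq> 1"
proof
  assume 1: "ldeg F y = 1"
  then have y: "y \<in> \<Union>F" using uhit_ldeg_pos_iff[OF F, of y] by simp
  then have "ldeg F (- y) \<ge> 1"
    using uhit_ldeg_pos_iff[OF F, of "- y"] uhit_lits_uminus[OF F y] by simp
  then have "min (ldeg F \<bar>y\<bar>) (ldeg F (- \<bar>y\<bar>)) = 1" using 1 by (auto simp: abs_if)
  moreover have "\<bar>y\<bar> \<in> vars F" using y unfolding vars_def lit_var_def by blast
  ultimately show False using ns unfolding nonsingular_def singular_var_def by blast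
qed

section \<open>An example with seven variables\<close>

text \<open>
  A variable 1 whose two branches carry, on disjoint variables, the largest nonsingular unsatisfiable
  hitting clause-set of deficiency 2.
\<close>

definition witness :: clause_set where
  "witness =
    {{1, 2, 3, 4}, {1, -2, -3, -4}, {1, 2, -3}, {1, 3, -4}, {1, 4, -2},
     {-1, 5, 6, 7}, {-1, -5, -6, -7}, {-1, 5, -6}, {-1, 6, -7}, {-1, 7, -5}}"

lemma vars_witness: "vars witness = {1, 2, 3, 4, 5, 6, 7}"
  unfolding vars_def lit_var_def witness_def by auto

lemma card_witness: "card witness = 10"
  unfolding witness_def by (simp add: card_insert_if set_eq_subset)

lemma is_clause_set_witness: "is_clause_set witness"
  unfolding witness_def is_clause_set_def is_clause_def by auto

lemma hitting_witness: "hitting witness"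
  unfolding witness_def hitting_def by simp blast

lemma unsatisfiable_witness: "\<not> satisfiable witness"
proof
  assume "satisfiable witness"
  then obtain C where C: "is_clause C" and CD: "\<forall>D\<in>witness. C \<inter> D \<noteq> {}"
    unfolding satisfiable_def by (elim exE conjE)
  have D: "\<exists>x\<in>D. x \<in> C" if "D \<in> witness" for D
    using bspec[OF CD that] by blast
  have "\<not> (x \<in> C \<and> - x \<in> C)" for x using C unfolding is_clause_def by blast
  \<comment> \<open>Only membership of the 14 literals over the variables 1 to 7 matters;
    consistency and the ten clauses give a propositional contradiction.\<close>
  from this[of 1] this[of 2] this[of 3] this[of 4] this[of 5] this[of 6] this[of 7]
    D[of "{1, 2, 3, 4}"] D[of "{1, -2, -3, -4}"] D[of "{1, 2, -3}"] D[of "{1, 3, -4}"]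
    D[of "{1, 4, -2}"] D[of "{-1, 5, 6, 7}"] D[of "{-1, -5, -6, -7}"] D[of "{-1, 5, -6}"]
    D[of "{-1, 6, -7}"] D[of "{-1, 7, -5}"]
  show False unfolding witness_def by simp argo
qed

lemma ldeg_empty: "ldeg {} x = 0"
  unfolding ldeg_def by simp

text \<open>Serves to evaluate degrees in an explicitly listed clause-set by simplification.\<close>

lemma ldeg_insert:
  assumes "finite F" "C \<notin> F"
  shows "ldeg (insert C F) x = (if x \<in> C then 1 else 0) + ldeg F x"
proof -
  have "{D \<in> insert C F. x \<in> D} = (if x \<in> C then insert C {D \<in> F. x \<in> D} else {D \<in> F. x \<in> D})"
    by auto
  then show ?thesis using assms unfolding ldeg_def by simp
qed

lemma nonsingular_witness: "nonsingular witness"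
proof -
  have "min (ldeg witness v) (ldeg witness (- v)) \<noteq> 1" if "v \<in> {1, 2, 3, 4, 5, 6, 7}" for v
    using that unfolding witness_def
    by (elim insertE emptyE) (simp_all add: ldeg_insert ldeg_empty set_eq_subset)
  then show ?thesis
    unfolding nonsingular_def singular_var_def vars_witness by blast
qed

theorem corollary11:
  shows "sup_num_vars 3 = enat (4 * 3 - 5) \<and> sup_num_vars 3 = enat 7 \<and>
    (\<forall>F. is_clause_set F \<and> nonsingular F \<and> \<not> satisfiable F \<and> hitting F \<and> deficiency F = 3
      \<longrightarrow> num_vars F \<le> 7)"
proof -
  have bound: "num_vars F \<le> 7"
    if "is_clause_set F" "nonsingular F" "\<not> satisfiable F" "hitting F" "deficiency F = 3" for F
  proof -
    have F: "uhit F" using uhitI that by blast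
    have c: "card F = num_vars F + 3"
      using that(5) unfolding deficiency_def num_clauses_def by linarith
    have "unit_lits F = {}" using nonsingular_ldeg[OF F that(2)] unfolding unit_lits_def by blast
    moreover have "F \<noteq> {{}}" using c by auto
    ultimately have "unit_count F = 0" unfolding unit_count_def by simp
    \<comment> \<open>With \<open>u = 0\<close> and \<open>c = n + 3\<close>, the inequality reads
      \<open>5 * n + 5 \<le> 4 * n + 12\<close>.\<close>
    then show ?thesis using num_vars_bound[OF F] c by linarith
  qed
  have num: "num_vars witness = 7" unfolding num_vars_def vars_witness by simp
  then have "deficiency witness = 3"
    unfolding deficiency_def num_clauses_def card_witness by simp
  then have wit: "witness \<in> nonsingular_uhit 3"
    unfolding nonsingular_uhit_def
    using is_clause_set_witness nonsingular_witness unsatisfiable_witness hitting_witness by simp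
  have "sup_num_vars 3 = enat 7"
    unfolding sup_num_vars_def
  proof (rule antisym)
    show "(SUP F\<in>nonsingular_uhit 3. enat (num_vars F)) \<le> enat 7"
      using bound unfolding nonsingular_uhit_def by (intro SUP_least) simp
    show "enat 7 \<le> (SUP F\<in>nonsingular_uhit 3. enat (num_vars F))"
      using SUP_upper[OF wit, of "\<lambda>F. enat (num_vars F)"] unfolding num .
  qed
  then show ?thesis using bound by simp
qed

end
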